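(* Let $(M,g)=(B\times_f F,\ g_B\oplus f^2 g_F)$ be a warped product of two Riemannian manifolds $(B,g_B)$ and $(F,g_F)$ with warping function $f$, $\dim B=m$ and $\dim F=n$. Let $(M,g,\mu,\xi)$ be a conformal Ricci soliton and suppose both $\xi_B$ and $\xi_F$ are Killing on the base $B$ and the fiber $F$ respectively. Then the manifold $(M,g)$ is Einstein if $\xi_B(f)=0$.
   Context: Warped product: for Riemannian manifolds $(B,g_B)$ (base) and $(F,g_F)$ (fiber) and a positive smooth function $f$ on $B$ (warping function), $M=B\times_f F$ is the product manifold $B\times F$ with metric $g=\pi^*g_B+(f\circ\pi)^2\sigma^*g_F$, where $\pi,\sigma$ are the projections onto $B$ and $F$; this metric is also written $g_B\oplus f^2g_F$. Conformal Ricci soliton: $(M,g,\mu,\xi)$ is a conformal Ricci soliton if $\mathcal{L}_\xi g+2\,Ric=\mu g$, where $\xi$ is a smooth vector field on $M$ and $\mu=2\lambda-(p+\frac2n)$, with $\lambda$ a real constant (soliton constant) and $p$ a scalar field (conformal pressure). Vector field convention: $\xi=\xi_B+\xi_F$, where $\xi_B$ and $\xi_F$ are (lifts to $M$ of) vector fields on $B$ and on $F$ respectively. A vector field $X$ on a Riemannian manifold $(N,h)$ is Killing if $\mathcal{L}_X h=0$. Einstein manifold: $Ric=\beta g$ for some scalar factor $\beta$ (in the paper's usage $\beta$ may be a smooth function). *)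

theory Defs
  imports "HOL-Analysis.Analysis"
begin

section \<open>Smooth maps between Euclidean spaces\<close>

fun higher_differentiable_on ::
  "'a::real_normed_vector set \<Rightarrow> ('a \<Rightarrow> 'b::real_normed_vector) \<Rightarrow> nat \<Rightarrow> bool" where
  "higher_differentiable_on S f 0 \<longleftrightarrow> continuous_on S f"
| "higher_differentiable_on S f (Suc n) \<longleftrightarrow>
     (\<forall>x\<in>S. f differentiable (at x)) \<and>
     (\<forall>v. higher_differentiable_on S (\<lambda>x. frechet_derivative f (at x) v) n)"

text \<open>Only used on open sets \<open>S\<close>.\<close>

definition smooth_on :: "'a::real_normed_vector set \<Rightarrow> ('a \<Rightarrow> 'b::real_normed_vector) \<Rightarrow> bool" where
  "smooth_on S f \<longleftrightarrow> (\<forall>n. higher_differentiable_on S f n)"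

section \<open>Smooth manifolds\<close>

text \<open>A manifold is given by an atlas, indexed by a set of labels. The points of the manifold are
  the points covered by the charts, and its dimension is the dimension of the model space \<open>'e\<close>.
  Labels (rather than the charts themselves) let the charts of a product be indexed by pairs.\<close>

record ('p, 'i, 'e) atlas =
  labels :: "'i set"
  chart_dom :: "'i \<Rightarrow> 'p set"
  chart_map :: "'i \<Rightarrow> 'p \<Rightarrow> 'e"

definition carrier :: "('p, 'i, 'e) atlas \<Rightarrow> 'p set" where
  "carrier A = (\<Union>i\<in>labels A. chart_dom A i)"

definition chart_img :: "('p, 'i, 'e) atlas \<Rightarrow> 'i \<Rightarrow> 'e set" where
  "chart_img A i = chart_map A i ` chart_dom A i"

definition chart_inv :: "('p, 'i, 'e) atlas \<Rightarrow> 'i \<Rightarrow> 'e \<Rightarrow> 'p" where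
  "chart_inv A i = inv_into (chart_dom A i) (chart_map A i)"

definition overlap :: "('p, 'i, 'e) atlas \<Rightarrow> 'i \<Rightarrow> 'i \<Rightarrow> 'e set" where
  "overlap A i j = chart_map A i ` (chart_dom A i \<inter> chart_dom A j)"

definition transition :: "('p, 'i, 'e) atlas \<Rightarrow> 'i \<Rightarrow> 'i \<Rightarrow> 'e \<Rightarrow> 'e" where
  "transition A i j = chart_map A j \<circ> chart_inv A i"

definition smooth_manifold ::
  "('p::{t2_space, second_countable_topology}, 'i, 'e::euclidean_space) atlas \<Rightarrow> bool" where
  "smooth_manifold A \<longleftrightarrow>
     (\<forall>i\<in>labels A. open (chart_dom A i) \<and> open (chart_img A i) \<and>
        homeomorphism (chart_dom A i) (chart_img A i) (chart_map A i) (chart_inv A i)) \<and>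
     (\<forall>i\<in>labels A. \<forall>j\<in>labels A. smooth_on (overlap A i j) (transition A i j))"

definition smooth_function :: "('p, 'i, 'e::euclidean_space) atlas \<Rightarrow> ('p \<Rightarrow> real) \<Rightarrow> bool" where
  "smooth_function A f \<longleftrightarrow> (\<forall>i\<in>labels A. smooth_on (chart_img A i) (f \<circ> chart_inv A i))"

section \<open>Tensor fields\<close>

text \<open>A tensor field is the family of its coordinate expressions in the charts of the atlas,
  subject to the tensorial transformation law under the transition maps. \<open>X i x\<close> is the
  coordinate vector of the vector field \<open>X\<close> at the point with coordinates \<open>x\<close> in the chart \<open>i\<close>,
  and \<open>h i x u v\<close> is the value of the (0,2)-tensor field \<open>h\<close> at that point on the tangent vectors
  with coordinates \<open>u\<close> and \<open>v\<close>. Values for \<open>i\<close> outside \<open>labels A\<close> or \<open>x\<close> outside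
  \<open>chart_img A i\<close> carry no meaning.\<close>

type_synonym ('i, 'e) vfield = "'i \<Rightarrow> 'e \<Rightarrow> 'e"
type_synonym ('i, 'e) tensor2 = "'i \<Rightarrow> 'e \<Rightarrow> 'e \<Rightarrow> 'e \<Rightarrow> real"

definition vector_field ::
  "('p, 'i, 'e::euclidean_space) atlas \<Rightarrow> ('i, 'e) vfield \<Rightarrow> bool" where
  "vector_field A X \<longleftrightarrow>
     (\<forall>i\<in>labels A. smooth_on (chart_img A i) (X i)) \<and>
     (\<forall>i\<in>labels A. \<forall>j\<in>labels A. \<forall>x\<in>overlap A i j.
        X j (transition A i j x) = frechet_derivative (transition A i j) (at x) (X i x))"

definition tensor2_field ::
  "('p, 'i, 'e::euclidean_space) atlas \<Rightarrow> ('i, 'e) tensor2 \<Rightarrow> bool" where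
  "tensor2_field A h \<longleftrightarrow>
     (\<forall>i\<in>labels A. \<forall>x\<in>chart_img A i. bilinear (h i x)) \<and>
     (\<forall>i\<in>labels A. \<forall>u v. smooth_on (chart_img A i) (\<lambda>x. h i x u v)) \<and>
     (\<forall>i\<in>labels A. \<forall>j\<in>labels A. \<forall>x\<in>overlap A i j. \<forall>u v.
        h j (transition A i j x)
          (frechet_derivative (transition A i j) (at x) u)
          (frechet_derivative (transition A i j) (at x) v) = h i x u v)"

definition riemannian_manifold ::
  "('p::{t2_space, second_countable_topology}, 'i, 'e::euclidean_space) atlas
     \<Rightarrow> ('i, 'e) tensor2 \<Rightarrow> bool" where
  "riemannian_manifold A g \<longleftrightarrow> smooth_manifold A \<and> tensor2_field A g \<and>
     (\<forall>i\<in>labels A. \<forall>x\<in>chart_img A i.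
        (\<forall>u v. g i x u v = g i x v u) \<and> (\<forall>u. u \<noteq> 0 \<longrightarrow> g i x u u > 0))"

text \<open>The function \<open>X(f)\<close>, in the chart \<open>i\<close>.\<close>

definition vf_apply ::
  "('p, 'i, 'e::euclidean_space) atlas \<Rightarrow> ('i, 'e) vfield \<Rightarrow> ('p \<Rightarrow> real) \<Rightarrow> 'i \<Rightarrow> 'e \<Rightarrow> real" where
  "vf_apply A X f i x = frechet_derivative (f \<circ> chart_inv A i) (at x) (X i x)"

text \<open>\<open>(L\<^sub>X h)\<^sub>a\<^sub>b = X\<^sup>c \<partial>\<^sub>c h\<^sub>a\<^sub>b + h\<^sub>c\<^sub>b \<partial>\<^sub>a X\<^sup>c + h\<^sub>a\<^sub>c \<partial>\<^sub>b X\<^sup>c\<close>\<close>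

definition lie_derivative ::
  "('i, 'e::euclidean_space) vfield \<Rightarrow> ('i, 'e) tensor2 \<Rightarrow> ('i, 'e) tensor2" where
  "lie_derivative X h i x u v =
     frechet_derivative (\<lambda>y. h i y u v) (at x) (X i x) +
     h i x (frechet_derivative (X i) (at x) u) v +
     h i x u (frechet_derivative (X i) (at x) v)"

definition killing ::
  "('p, 'i, 'e::euclidean_space) atlas \<Rightarrow> ('i, 'e) tensor2 \<Rightarrow> ('i, 'e) vfield \<Rightarrow> bool" where
  "killing A h X \<longleftrightarrow>
     (\<forall>i\<in>labels A. \<forall>x\<in>chart_img A i. \<forall>u v. lie_derivative X h i x u v = 0)"

section \<open>Ricci curvature\<close>

text \<open>\<open>flat g i x u\<close> is the vector \<open>w\<close> with \<open>w \<bullet> v = g i x u v\<close> for all \<open>v\<close>, where the inner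
  product is that of the coordinate space; so \<open>inv (flat g i x)\<close> is given by the inverse of the
  matrix of \<open>g\<close>.\<close>

definition flat :: "('i, 'e::euclidean_space) tensor2 \<Rightarrow> 'i \<Rightarrow> 'e \<Rightarrow> 'e \<Rightarrow> 'e" where
  "flat g i x u = (\<Sum>b\<in>Basis. g i x u b *\<^sub>R b)"

text \<open>\<open>christoffel g i x u v\<close> has components \<open>\<Gamma>\<^sup>c\<^sub>a\<^sub>b u\<^sup>a v\<^sup>b\<close>; it is the covariant derivative of the
  constant coordinate field \<open>v\<close> along \<open>u\<close>.\<close>

definition christoffel ::
  "('i, 'e::euclidean_space) tensor2 \<Rightarrow> 'i \<Rightarrow> 'e \<Rightarrow> 'e \<Rightarrow> 'e \<Rightarrow> 'e" where
  "christoffel g i x u v = inv (flat g i x)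
     (\<Sum>d\<in>Basis. ((frechet_derivative (\<lambda>y. g i y v d) (at x) u +
                   frechet_derivative (\<lambda>y. g i y u d) (at x) v -
                   frechet_derivative (\<lambda>y. g i y u v) (at x) d) / 2) *\<^sub>R d)"

text \<open>\<open>R(u,v)w = \<nabla>\<^sub>u\<nabla>\<^sub>v w - \<nabla>\<^sub>v\<nabla>\<^sub>u w\<close> for constant coordinate fields \<open>u\<close>, \<open>v\<close>, \<open>w\<close>.\<close>

definition curvature ::
  "('i, 'e::euclidean_space) tensor2 \<Rightarrow> 'i \<Rightarrow> 'e \<Rightarrow> 'e \<Rightarrow> 'e \<Rightarrow> 'e \<Rightarrow> 'e" where
  "curvature g i x u v w =
     frechet_derivative (\<lambda>y. christoffel g i y v w) (at x) u -
     frechet_derivative (\<lambda>y. christoffel g i y u w) (at x) v +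
     christoffel g i x u (christoffel g i x v w) -
     christoffel g i x v (christoffel g i x u w)"

text \<open>The trace of \<open>u \<mapsto> R(u,v)w\<close>; with these signs round spheres have positive Ricci curvature.\<close>

definition ricci :: "('i, 'e::euclidean_space) tensor2 \<Rightarrow> ('i, 'e) tensor2" where
  "ricci g i x v w = (\<Sum>b\<in>Basis. curvature g i x b v w \<bullet> b)"

section \<open>Einstein manifolds and conformal Ricci solitons\<close>

definition einstein ::
  "('p, 'i, 'e::euclidean_space) atlas \<Rightarrow> ('i, 'e) tensor2 \<Rightarrow> bool" where
  "einstein A g \<longleftrightarrow> (\<exists>\<beta>. smooth_function A \<beta> \<and>
     (\<forall>i\<in>labels A. \<forall>x\<in>chart_img A i. \<forall>u v.
        ricci g i x u v = \<beta> (chart_inv A i x) * g i x u v))"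

text \<open>In \<open>\<mu> = 2\<lambda> - (p + 2/n)\<close>, \<open>n\<close> is the dimension of the manifold carrying the soliton; for a
  warped product this is the dimension of the total space, not of the fiber.\<close>

definition conformal_ricci_soliton ::
  "('p, 'i, 'e::euclidean_space) atlas \<Rightarrow> ('i, 'e) tensor2 \<Rightarrow> ('p \<Rightarrow> real)
     \<Rightarrow> ('i, 'e) vfield \<Rightarrow> bool" where
  "conformal_ricci_soliton A g \<mu> \<xi> \<longleftrightarrow> vector_field A \<xi> \<and>
     (\<exists>(l::real) p. smooth_function A p \<and>
        (\<forall>q\<in>carrier A. \<mu> q = 2 * l - (p q + 2 / real DIM('e)))) \<and>
     (\<forall>i\<in>labels A. \<forall>x\<in>chart_img A i. \<forall>u v.
        lie_derivative \<xi> g i x u v + 2 * ricci g i x u v = \<mu> (chart_inv A i x) * g i x u v)"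

section \<open>Warped products\<close>

definition prod_atlas ::
  "('p, 'i, 'a) atlas \<Rightarrow> ('q, 'j, 'b) atlas \<Rightarrow> ('p \<times> 'q, 'i \<times> 'j, 'a \<times> 'b) atlas" where
  "prod_atlas B F =
     \<lparr>labels = labels B \<times> labels F,
      chart_dom = (\<lambda>(i, j). chart_dom B i \<times> chart_dom F j),
      chart_map = (\<lambda>(i, j). map_prod (chart_map B i) (chart_map F j))\<rparr>"

definition pullback_base ::
  "('i, 'a) tensor2 \<Rightarrow> ('i \<times> 'j, 'a \<times> 'b) tensor2" where
  "pullback_base h k z u v = h (fst k) (fst z) (fst u) (fst v)"

definition pullback_fiber ::
  "('j, 'b) tensor2 \<Rightarrow> ('i \<times> 'j, 'a \<times> 'b) tensor2" where
  "pullback_fiber h k z u v = h (snd k) (snd z) (snd u) (snd v)"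

definition warped_metric ::
  "('p, 'i, 'a) atlas \<Rightarrow> ('q, 'j, 'b) atlas \<Rightarrow> ('i, 'a) tensor2 \<Rightarrow> ('p \<Rightarrow> real) \<Rightarrow> ('j, 'b) tensor2
     \<Rightarrow> ('i \<times> 'j, 'a \<times> 'b) tensor2" where
  "warped_metric B F gB f gF k z u v =
     pullback_base gB k z u v +
     ((f \<circ> fst) (chart_inv (prod_atlas B F) k z))\<^sup>2 * pullback_fiber gF k z u v"

definition lift_base :: "('i, 'a) vfield \<Rightarrow> ('i \<times> 'j, 'a \<times> 'b::zero) vfield" where
  "lift_base X k z = (X (fst k) (fst z), 0)"

definition lift_fiber :: "('j, 'b) vfield \<Rightarrow> ('i \<times> 'j, 'a::zero \<times> 'b) vfield" where
  "lift_fiber Y k z = (0, Y (snd k) (snd z))"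

definition vf_add :: "('i, 'e::plus) vfield \<Rightarrow> ('i, 'e) vfield \<Rightarrow> ('i, 'e) vfield" where
  "vf_add X Y i x = X i x + Y i x"

end

theory Submission
  imports Defs
begin

text \<open>
  For \<open>\<xi> = \<xi>\<^sub>B + \<xi>\<^sub>F\<close> the product rule gives
  \<open>L\<^sub>\<xi> (g\<^sub>B \<oplus> f\<^sup>2 g\<^sub>F) = L\<^sub>\<xi>\<^sub>B g\<^sub>B + 2 f \<xi>\<^sub>B(f) g\<^sub>F + f\<^sup>2 L\<^sub>\<xi>\<^sub>F g\<^sub>F\<close>
  (lemma \<open>lie_derivative_warped_metric\<close>). If both fields are Killing and \<open>\<xi>\<^sub>B(f) = 0\<close>, all three
  summands vanish, so \<open>\<xi>\<close> is a Killing field of the warped product. The soliton equation then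
  reads \<open>2 Ric = \<mu> g\<close>, which is the Einstein condition with factor \<open>\<mu>/2\<close>; the curvature of the
  warped product never has to be computed. The factor is smooth because \<open>\<mu>\<close> is an affine function
  of the conformal pressure.
\<close>

text \<open>Openness of \<open>S\<close> makes the derivatives at points of \<open>S\<close> depend on the values in \<open>S\<close> only.\<close>

lemma higher_differentiable_on_cong:
  assumes "open S" and "\<And>x. x \<in> S \<Longrightarrow> f x = g x"
  shows "higher_differentiable_on S f n \<longleftrightarrow> higher_differentiable_on S g n"
  using assms(2)
proof (induction n arbitrary: f g)
  case 0
  then show ?case by (simp cong: continuous_on_cong)
next
  case (Suc n)
  have D: "(f has_derivative D) (at x) \<longleftrightarrow> (g has_derivative D) (at x)" if "x \<in> S" for x D
    using has_derivative_transform_within_open[OF _ assms(1) that] Suc.prems by metis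
  have "f differentiable (at x) \<longleftrightarrow> g differentiable (at x)" if "x \<in> S" for x
    using D[OF that] by (simp add: differentiable_def)
  moreover have "frechet_derivative f (at x) = frechet_derivative g (at x)" if "x \<in> S" for x
    using D[OF that] by (simp add: frechet_derivative_def)
  ultimately show ?case
    using Suc.IH[of "\<lambda>x. frechet_derivative f (at x) v" "\<lambda>x. frechet_derivative g (at x) v" for v]
    by simp
qed

text \<open>Differentiating \<open>c + a h\<close> turns the constant \<open>c\<close> into \<open>0\<close>, so the induction on the order
  of differentiability has to range over all \<open>c\<close>.\<close>

lemma higher_differentiable_on_affine:
  fixes h :: "'a::real_normed_vector \<Rightarrow> real"
  assumes "open S" and "higher_differentiable_on S h n"
  shows "higher_differentiable_on S (\<lambda>x. c + a * h x) n"
  using assms(2)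
proof (induction n arbitrary: h c)
  case 0
  then show ?case by (auto intro!: continuous_intros)
next
  case (Suc n)
  have D: "((\<lambda>x. c + a * h x) has_derivative (\<lambda>v. a * frechet_derivative h (at x) v)) (at x)"
    if "x \<in> S" for x
    using Suc.prems that by (auto intro!: derivative_eq_intros simp: frechet_derivative_works)
  have "frechet_derivative (\<lambda>x. c + a * h x) (at x) v = 0 + a * frechet_derivative h (at x) v"
    if "x \<in> S" for x v
    using frechet_derivative_at[OF D[OF that]] by (metis add_0)
  moreover have "higher_differentiable_on S (\<lambda>x. 0 + a * frechet_derivative h (at x) v) n" for v
    using Suc.IH[of "\<lambda>x. frechet_derivative h (at x) v" 0] Suc.prems by simp
  ultimately have "higher_differentiable_on S (\<lambda>x. frechet_derivative (\<lambda>x. c + a * h x) (at x) v) n"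
    for v
    using higher_differentiable_on_cong[OF assms(1)] by (metis (no_types, lifting))
  then show ?case
    using D by (auto simp: differentiable_def)
qed

lemma smooth_on_has_derivative:
  assumes "smooth_on S f" and "x \<in> S"
  shows "(f has_derivative frechet_derivative f (at x)) (at x)"
proof -
  have "higher_differentiable_on S f (Suc 0)"
    using assms(1) unfolding smooth_on_def by blast
  then show ?thesis
    using assms(2) by (simp add: frechet_derivative_works)
qed

lemma smooth_function_affine:
  assumes "\<And>i. i \<in> labels A \<Longrightarrow> open (chart_img A i)" and "smooth_function A h"
  shows "smooth_function A (\<lambda>q. c + a * h q)"
  using assms higher_differentiable_on_affine
  unfolding smooth_function_def smooth_on_def comp_def by blast

lemma labels_prod_atlas: "labels (prod_atlas B F) = labels B \<times> labels F"
  by (simp add: prod_atlas_def)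

lemma chart_img_prod_atlas:
  "chart_img (prod_atlas B F) (i, j) = chart_img B i \<times> chart_img F j"
  by (auto simp: prod_atlas_def chart_img_def map_prod_def)

lemma chart_inv_in_carrier:
  assumes "i \<in> labels A" and "x \<in> chart_img A i"
  shows "chart_inv A i x \<in> carrier A"
  using assms inv_into_into[of x "chart_map A i" "chart_dom A i"]
  unfolding carrier_def chart_img_def chart_inv_def by blast

lemma chart_inv_prod_atlas:
  assumes "inj_on (chart_map B i) (chart_dom B i)" and "inj_on (chart_map F j) (chart_dom F j)"
    and "x \<in> chart_img B i" and "y \<in> chart_img F j"
  shows "chart_inv (prod_atlas B F) (i, j) (x, y) = (chart_inv B i x, chart_inv F j y)"
proof -
  have "inj_on (map_prod (chart_map B i) (chart_map F j)) (chart_dom B i \<times> chart_dom F j)"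
    using assms(1,2) by (rule map_prod_inj_on)
  then show ?thesis
    using assms(3,4) unfolding chart_inv_def prod_atlas_def chart_img_def
    by (auto intro!: inv_into_f_eq simp: inv_into_into f_inv_into_f)
qed

lemma smooth_manifold_open_chart_img:
  "smooth_manifold A \<Longrightarrow> i \<in> labels A \<Longrightarrow> open (chart_img A i)"
  unfolding smooth_manifold_def by blast

lemma smooth_manifold_inj_on_chart_map:
  assumes "smooth_manifold A" and "i \<in> labels A"
  shows "inj_on (chart_map A i) (chart_dom A i)"
proof -
  have "homeomorphism (chart_dom A i) (chart_img A i) (chart_map A i) (chart_inv A i)"
    using assms unfolding smooth_manifold_def by blast
  then show ?thesis
    by (metis homeomorphism_apply1 inj_on_inverseI)
qed

text \<open>The fiber directions contribute nothing to the derivative of \<open>f \<circ> \<pi>\<close>, so only \<open>\<xi>\<^sub>B\<close> sees the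
  warping function; the cross term is \<open>\<xi>\<^sub>B(f\<^sup>2) = 2 f \<xi>\<^sub>B(f)\<close> times the metric of the fiber.\<close>

lemma lie_derivative_warped_metric:
  assumes B: "smooth_manifold B" "tensor2_field B g\<^sub>B" "vector_field B X" "smooth_function B f"
    and F: "smooth_manifold F" "tensor2_field F g\<^sub>F" "vector_field F Y"
    and i: "i \<in> labels B" "x \<in> chart_img B i"
    and j: "j \<in> labels F" "y \<in> chart_img F j"
  shows "lie_derivative (vf_add (lift_base X) (lift_fiber Y)) (warped_metric B F g\<^sub>B f g\<^sub>F)
           (i, j) (x, y) u v =
         lie_derivative X g\<^sub>B i x (fst u) (fst v) +
         2 * f (chart_inv B i x) * vf_apply B X f i x * g\<^sub>F j y (snd u) (snd v) +
         (f (chart_inv B i x))\<^sup>2 * lie_derivative Y g\<^sub>F j y (snd u) (snd v)"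
proof -
  let ?\<xi> = "vf_add (lift_base X) (lift_fiber Y)"
  let ?g = "warped_metric B F g\<^sub>B f g\<^sub>F"
  let ?h = "f \<circ> chart_inv B i"
  have field: "?\<xi> (i, j) = (\<lambda>z. (X i (fst z), Y j (snd z)))"
    by (auto simp: vf_add_def lift_base_def lift_fiber_def)
  \<comment> \<open>Outside the chart image the inverse chart is arbitrary, so this coordinate expression can be
    differentiated in place of the metric only because the chart image is open.\<close>
  have metric: "?g (i, j) z u v =
      g\<^sub>B i (fst z) (fst u) (fst v) + (?h (fst z))\<^sup>2 * g\<^sub>F j (snd z) (snd u) (snd v)"
    if "z \<in> chart_img B i \<times> chart_img F j" for z u v
    using that
      chart_inv_prod_atlas[OF smooth_manifold_inj_on_chart_map[OF B(1) i(1)]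
        smooth_manifold_inj_on_chart_map[OF F(1) j(1)]]
    by (auto simp: warped_metric_def pullback_base_def pullback_fiber_def)
  have X: "(X i has_derivative frechet_derivative (X i) (at x)) (at x)"
    and f: "(?h has_derivative frechet_derivative ?h (at x)) (at x)"
    and gB: "((\<lambda>x. g\<^sub>B i x (fst u) (fst v)) has_derivative
              frechet_derivative (\<lambda>x. g\<^sub>B i x (fst u) (fst v)) (at x)) (at x)"
    using B i by (auto intro!: smooth_on_has_derivative
        simp: vector_field_def smooth_function_def tensor2_field_def)
  have Y: "(Y j has_derivative frechet_derivative (Y j) (at y)) (at y)"
    and gF: "((\<lambda>y. g\<^sub>F j y (snd u) (snd v)) has_derivative
              frechet_derivative (\<lambda>y. g\<^sub>F j y (snd u) (snd v)) (at y)) (at y)"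
    using F j by (auto intro!: smooth_on_has_derivative simp: vector_field_def tensor2_field_def)
  note along_fst = has_derivative_compose[OF has_derivative_fst[OF has_derivative_ident]]
  note along_snd = has_derivative_compose[OF has_derivative_snd[OF has_derivative_ident]]
  have "(?\<xi> (i, j) has_derivative (\<lambda>w. (frechet_derivative (X i) (at x) (fst w),
           frechet_derivative (Y j) (at y) (snd w)))) (at (x, y))"
    unfolding field
    using has_derivative_Pair[OF along_fst[where g = "X i" and x = "(x, y)" and s = UNIV]
        along_snd[where g = "Y j" and x = "(x, y)" and s = UNIV]] X Y by simp
  from frechet_derivative_at[OF this]
  have d_field: "frechet_derivative (?\<xi> (i, j)) (at (x, y)) =
      (\<lambda>w. (frechet_derivative (X i) (at x) (fst w), frechet_derivative (Y j) (at y) (snd w)))"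
    by simp
  have f': "((\<lambda>z. ?h (fst z)) has_derivative (\<lambda>w. frechet_derivative ?h (at x) (fst w)))
      (at (x, y))"
    using along_fst[where g = ?h and x = "(x, y)" and s = UNIV] f by simp
  have gB': "((\<lambda>z. g\<^sub>B i (fst z) (fst u) (fst v)) has_derivative
      (\<lambda>w. frechet_derivative (\<lambda>x. g\<^sub>B i x (fst u) (fst v)) (at x) (fst w))) (at (x, y))"
    using along_fst[where g = "\<lambda>x. g\<^sub>B i x (fst u) (fst v)" and x = "(x, y)" and s = UNIV] gB by simp
  have gF': "((\<lambda>z. g\<^sub>F j (snd z) (snd u) (snd v)) has_derivative
      (\<lambda>w. frechet_derivative (\<lambda>y. g\<^sub>F j y (snd u) (snd v)) (at y) (snd w))) (at (x, y))"
    using along_snd[where g = "\<lambda>y. g\<^sub>F j y (snd u) (snd v)" and x = "(x, y)" and s = UNIV] gF by simp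
  let ?D = "\<lambda>w. frechet_derivative (\<lambda>x. g\<^sub>B i x (fst u) (fst v)) (at x) (fst w) +
      2 * ?h x * frechet_derivative ?h (at x) (fst w) * g\<^sub>F j y (snd u) (snd v) +
      (?h x)\<^sup>2 * frechet_derivative (\<lambda>y. g\<^sub>F j y (snd u) (snd v)) (at y) (snd w)"
  have "((\<lambda>z. g\<^sub>B i (fst z) (fst u) (fst v) + (?h (fst z))\<^sup>2 * g\<^sub>F j (snd z) (snd u) (snd v))
      has_derivative ?D) (at (x, y))"
    unfolding power2_eq_square
    by (rule has_derivative_eq_rhs,
        rule has_derivative_add[OF gB' has_derivative_mult[OF has_derivative_mult[OF f' f'] gF']])
      (simp add: fun_eq_iff algebra_simps)
  moreover have "open (chart_img B i \<times> chart_img F j)"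
    by (intro open_Times smooth_manifold_open_chart_img B(1) F(1) i(1) j(1))
  ultimately have "((\<lambda>z. ?g (i, j) z u v) has_derivative ?D) (at (x, y))"
    by (rule has_derivative_transform_within_open) (use i j metric in auto)
  from frechet_derivative_at[OF this]
  have d_metric: "frechet_derivative (\<lambda>z. ?g (i, j) z u v) (at (x, y)) = ?D"
    by simp
  show ?thesis
    unfolding lie_derivative_def[of ?\<xi>] d_metric d_field
    using i j by (simp add: metric field lie_derivative_def vf_apply_def algebra_simps)
qed

theorem theorem3p2:
  fixes B :: "('p::{t2_space, second_countable_topology}, 'i, 'a::euclidean_space) atlas"
    and F :: "('q::{t2_space, second_countable_topology}, 'j, 'b::euclidean_space) atlas"
    and g\<^sub>B :: "('i, 'a) tensor2" and g\<^sub>F :: "('j, 'b) tensor2"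
    and f :: "'p \<Rightarrow> real" and \<mu> :: "'p \<times> 'q \<Rightarrow> real"
    and \<xi>\<^sub>B :: "('i, 'a) vfield" and \<xi>\<^sub>F :: "('j, 'b) vfield"
  assumes "riemannian_manifold B g\<^sub>B"
    and "riemannian_manifold F g\<^sub>F"
    and "smooth_function B f"
    and "\<forall>p\<in>carrier B. f p > 0"
    and "vector_field B \<xi>\<^sub>B"
    and "vector_field F \<xi>\<^sub>F"
    and "conformal_ricci_soliton (prod_atlas B F) (warped_metric B F g\<^sub>B f g\<^sub>F) \<mu>
           (vf_add (lift_base \<xi>\<^sub>B) (lift_fiber \<xi>\<^sub>F))"
    and "killing B g\<^sub>B \<xi>\<^sub>B"
    and "killing F g\<^sub>F \<xi>\<^sub>F"
    and "\<forall>i\<in>labels B. \<forall>x\<in>chart_img B i. vf_apply B \<xi>\<^sub>B f i x = 0"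
  shows "einstein (prod_atlas B F) (warped_metric B F g\<^sub>B f g\<^sub>F)"
proof -
  let ?M = "prod_atlas B F" and ?g = "warped_metric B F g\<^sub>B f g\<^sub>F"
  let ?\<xi> = "vf_add (lift_base \<xi>\<^sub>B) (lift_fiber \<xi>\<^sub>F)"
  have B: "smooth_manifold B" "tensor2_field B g\<^sub>B"
    and F: "smooth_manifold F" "tensor2_field F g\<^sub>F"
    using assms(1,2) unfolding riemannian_manifold_def by auto
  obtain l p where p: "smooth_function ?M p"
    and \<mu>: "\<And>q. q \<in> carrier ?M \<Longrightarrow> \<mu> q = 2 * l - (p q + 2 / real DIM('a \<times> 'b))"
    and soliton: "\<And>k z u v. k \<in> labels ?M \<Longrightarrow> z \<in> chart_img ?M k \<Longrightarrow>
      lie_derivative ?\<xi> ?g k z u v + 2 * ricci ?g k z u v = \<mu> (chart_inv ?M k z) * ?g k z u v"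
    using assms(7) unfolding conformal_ricci_soliton_def by blast
  have "killing ?M ?g ?\<xi>"
    using lie_derivative_warped_metric[OF B assms(5,3) F assms(6)] assms(8-10)
    unfolding killing_def by (auto simp: labels_prod_atlas chart_img_prod_atlas)
  \<comment> \<open>The formula for \<open>\<mu>/2\<close> in terms of \<open>p\<close>, taken on the whole type: \<open>\<mu>\<close> itself is
    constrained only at points of the manifold.\<close>
  define \<beta> where "\<beta> = (\<lambda>q. (l - 1 / real DIM('a \<times> 'b)) + (- 1 / 2) * p q)"
  have "open (chart_img ?M k)" if "k \<in> labels ?M" for k
    using that smooth_manifold_open_chart_img[OF B(1)] smooth_manifold_open_chart_img[OF F(1)]
    by (auto simp: labels_prod_atlas chart_img_prod_atlas intro!: open_Times)
  then have "smooth_function ?M \<beta>"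
    unfolding \<beta>_def using p by (rule smooth_function_affine)
  moreover have "ricci ?g k z u v = \<beta> (chart_inv ?M k z) * ?g k z u v"
    if k: "k \<in> labels ?M" and z: "z \<in> chart_img ?M k" for k z u v
  proof -
    have "lie_derivative ?\<xi> ?g k z u v = 0"
      using \<open>killing ?M ?g ?\<xi>\<close> k z unfolding killing_def by blast
    moreover have "\<mu> (chart_inv ?M k z) = 2 * \<beta> (chart_inv ?M k z)"
      unfolding \<mu>[OF chart_inv_in_carrier[OF k z]] by (simp add: \<beta>_def algebra_simps)
    ultimately show ?thesis
      using soliton[OF k z, of u v] by simp
  qed
  ultimately show ?thesis
    unfolding einstein_def by blast
qed

end
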